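(* Let $m,\ell$ be coprime integers with $\ell>m$, let $c_1,c_2$ be nonzero real numbers, and let $f(t)=c_1e^{itm}+c_2e^{it\ell}$, $t\in\mathbb{R}$. Suppose that $w_0=f(t_0)=f(s_0)\neq0$ $(t_0\not\equiv s_0\bmod 2\pi)$ is a self-intersection point of the curve $f$. If the number $\ell-m$ is odd, then one and only one member of the module class $\{w_k:0\le k\le\ell-m-1\}$, $w_k=f\big(t_0+\tfrac{2k\pi}{\ell-m}\big)$, is real.
   Context: Write $f=x+iy$ with $x,y$ real-valued. The point $w_0=f(t_0)=f(s_0)$ is a self-intersection point of the curve $f$ if the curve has different tangent lines there, i.e. $\dot y(t_0)/\dot x(t_0)\neq\dot y(s_0)/\dot x(s_0)$ (slope $\infty$ allowed when $\dot x=0\ne\dot y$). With $t_k=t_0+2k\pi/(\ell-m)$ and $s_k=s_0+2k\pi/(\ell-m)$, the self-intersection points $w_k=f(t_k)=f(s_k)$, $0\le k\le\ell-m-1$, form the module class of $w_0$. *)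

theory Defs
  imports "HOL-Analysis.Analysis" "HOL-Library.Real_Mod"
begin

definition xdot :: "(real \<Rightarrow> complex) \<Rightarrow> real \<Rightarrow> real" where
  "xdot f t = deriv (\<lambda>s. Re (f s)) t"

definition ydot :: "(real \<Rightarrow> complex) \<Rightarrow> real \<Rightarrow> real" where
  "ydot f t = deriv (\<lambda>s. Im (f s)) t"

text \<open>The slope is defined only where the velocity does not vanish. Vertical lines get the single
  value \<open>\<infinity>\<close> (never \<open>-\<infinity>\<close>), so that equal slopes mean parallel tangent lines. At a zero of the
  velocity the value below is meaningless.\<close>

definition has_slope :: "(real \<Rightarrow> complex) \<Rightarrow> real \<Rightarrow> bool" where
  "has_slope f t \<longleftrightarrow> xdot f t \<noteq> 0 \<or> ydot f t \<noteq> 0"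

definition slope :: "(real \<Rightarrow> complex) \<Rightarrow> real \<Rightarrow> ereal" where
  "slope f t = (if xdot f t = 0 then \<infinity> else ereal (ydot f t / xdot f t))"

definition self_intersection_point ::
    "(real \<Rightarrow> complex) \<Rightarrow> real \<Rightarrow> real \<Rightarrow> complex \<Rightarrow> bool" where
  "self_intersection_point f t s w \<longleftrightarrow>
     w = f t \<and> w = f s \<and> has_slope f t \<and> has_slope f s \<and> slope f t \<noteq> slope f s"

definition module_class :: "(real \<Rightarrow> complex) \<Rightarrow> int \<Rightarrow> int \<Rightarrow> real \<Rightarrow> complex set" where
  "module_class f m l t =
     {f (t + 2 * of_int k * pi / of_int (l - m)) | k. 0 \<le> k \<and> k \<le> l - m - 1}"

end

theory Submission
  imports Defs
begin

text \<open>
  Put \<open>n = l - m\<close> and \<open>f t = c1 * cis (m * t) + c2 * cis (l * t)\<close>. Since \<open>l\<close> and \<open>m\<close> agree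
  modulo \<open>n\<close>, the shift of the parameter by \<open>2 * k * pi / n\<close> multiplies both terms by the same
  \<open>n\<close>-th root of unity, so the curve is mapped to itself by a rotation
  (lemma \<open>two_freq_shift\<close>); as \<open>c1\<close> and \<open>c2\<close> are real, it is also symmetric in the real axis
  (\<open>two_freq_minus\<close>). These two symmetries account for every self-intersection outside the origin:
  the modulus of \<open>f t\<close> determines \<open>cos (n * t)\<close>, so a point visited at the parameters
  \<open>t\<close> and \<open>s\<close> forces \<open>n * s\<close> to be congruent to \<open>n * t\<close> or to \<open>- n * t\<close> modulo \<open>2 * pi\<close>.
  In the first case one visit is a rotated copy of the other, and since \<open>m\<close> is
  coprime to \<open>n\<close> the rotation is trivial only if \<open>t\<close> and \<open>s\<close> are congruent. In the second case
  (\<open>double_point_parameters\<close>) a reflection relates the two visits, whence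
  \<open>w = cis (2 * pi * m * j / n) * cnj w\<close> for the common value \<open>w\<close> and some integer \<open>j\<close>.

  The member of the module class with index \<open>k\<close> is \<open>w\<close> rotated by \<open>2 * pi * m * k / n\<close>.
  It equals its own conjugate exactly when \<open>n\<close> divides \<open>m * (2 * k + j)\<close>, that is, when \<open>n\<close>
  divides \<open>2 * k + j\<close>. For odd \<open>n\<close> the number 2 is invertible modulo \<open>n\<close>, and
  exactly one residue \<open>k\<close> satisfies this congruence.
\<close>

definition two_freq :: "int \<Rightarrow> int \<Rightarrow> real \<Rightarrow> real \<Rightarrow> real \<Rightarrow> complex" where
  "two_freq m l c1 c2 t = of_real c1 * cis (of_int m * t) + of_real c2 * cis (of_int l * t)"

text \<open>This is the statement that \<open>cis (2 * pi * m / n)\<close> is a primitive \<open>n\<close>-th root of unity.\<close>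

lemma cis_rational_eq_1_iff:
  fixes m n k :: int
  assumes "n > 0" and "coprime m n"
  shows "cis (2 * pi * of_int m * of_int k / of_int n) = 1 \<longleftrightarrow> n dvd k"
proof -
  have "2 * pi * of_int m * of_int k / of_int n = 2 * pi * of_int j \<longleftrightarrow> m * k = n * j" for j :: int
  proof -
    have "2 * pi * of_int m * of_int k / of_int n = 2 * pi * of_int j
        \<longleftrightarrow> real_of_int m * of_int k = of_int n * of_int j"
      using assms(1) by (auto simp: field_simps)
    also have "\<dots> \<longleftrightarrow> m * k = n * j"
      by (metis of_int_eq_iff of_int_mult)
    finally show ?thesis .
  qed
  hence "cis (2 * pi * of_int m * of_int k / of_int n) = 1 \<longleftrightarrow> n dvd m * k"
    unfolding cis_eq_1_iff dvd_def by (auto simp: mult_ac)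
  also have "\<dots> \<longleftrightarrow> n dvd k"
    using assms(2) by (simp add: coprime_dvd_mult_right_iff coprime_commute)
  finally show ?thesis .
qed

lemma coprime_diff_right_int:
  fixes m l :: int
  assumes "coprime m l"
  shows "coprime m (l - m)"
proof (rule coprimeI)
  fix d assume "d dvd m" and "d dvd l - m"
  then have "d dvd l"
    using dvd_add[of d "l - m" m] by simp
  with assms \<open>d dvd m\<close> show "is_unit d"
    by (rule coprime_common_divisor)
qed

lemma two_freq_minus: "two_freq m l c1 c2 (- t) = cnj (two_freq m l c1 c2 t)"
  by (simp add: two_freq_def cis_cnj)

lemma two_freq_shift:
  assumes "l \<noteq> m"
  shows "two_freq m l c1 c2 (t + 2 * of_int k * pi / of_int (l - m)) =
         cis (2 * pi * of_int m * of_int k / of_int (l - m)) * two_freq m l c1 c2 t"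
proof -
  let ?a = "2 * pi * of_int m * of_int k / of_int (l - m)"
  have n: "real_of_int (l - m) \<noteq> 0"
    using assms by simp
  have m: "of_int m * (t + 2 * of_int k * pi / of_int (l - m)) = ?a + of_int m * t"
    by (simp add: algebra_simps)
  \<comment> \<open>Since \<open>l = m + (l - m)\<close>, the second phase gains \<open>k\<close> full turns more than the first.\<close>
  have "of_int l * (t + 2 * of_int k * pi / of_int (l - m)) =
        ?a + of_int l * t + 2 * pi * of_int k"
    using n by (simp add: divide_simps) (simp add: algebra_simps)
  moreover have "cis (2 * pi * of_int k) = 1"
    by simp
  ultimately have l: "cis (of_int l * (t + 2 * of_int k * pi / of_int (l - m))) =
        cis ?a * cis (of_int l * t)"
    by (simp flip: cis_mult)
  show ?thesis
    unfolding two_freq_def l m by (simp add: algebra_simps flip: cis_mult)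
qed

lemma norm_two_freq:
  "(norm (two_freq m l c1 c2 t))\<^sup>2 = c1\<^sup>2 + c2\<^sup>2 + 2 * c1 * c2 * cos (of_int (l - m) * t)"
proof -
  have norm: "(cos x)\<^sup>2 + (sin x)\<^sup>2 = 1" for x :: real
    by simp
  have diff: "cos (of_int (l - m) * t) = cos (of_int l * t) * cos (of_int m * t)
      + sin (of_int l * t) * sin (of_int m * t)"
    by (simp add: left_diff_distrib cos_diff)
  have "(norm (two_freq m l c1 c2 t))\<^sup>2 =
      (c1 * cos (of_int m * t) + c2 * cos (of_int l * t))\<^sup>2
      + (c1 * sin (of_int m * t) + c2 * sin (of_int l * t))\<^sup>2"
    by (simp add: two_freq_def cmod_power2)
  also have "\<dots> = c1\<^sup>2 * ((cos (of_int m * t))\<^sup>2 + (sin (of_int m * t))\<^sup>2)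
      + c2\<^sup>2 * ((cos (of_int l * t))\<^sup>2 + (sin (of_int l * t))\<^sup>2)
      + 2 * c1 * c2 * (cos (of_int l * t) * cos (of_int m * t)
      + sin (of_int l * t) * sin (of_int m * t))"
    by algebra
  finally show ?thesis
    unfolding diff norm by simp
qed

text \<open>
  Equal moduli leave only the two sign choices in \<open>s = \<plusminus> t\<close> modulo \<open>2 * pi / (l - m)\<close>; the plus
  sign makes one value a rotation of the other by a power of a primitive root of unity, which
  fixes a nonzero point only when it is the identity, and then \<open>t\<close> and \<open>s\<close> are congruent.
\<close>

lemma double_point_parameters:
  assumes "coprime m l" and "l > m" and "c1 \<noteq> 0" and "c2 \<noteq> 0"
    and eq: "two_freq m l c1 c2 t = two_freq m l c1 c2 s"
    and nz: "two_freq m l c1 c2 t \<noteq> 0"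
    and ncong: "\<not> [t = s] (rmod (2 * pi))"
  obtains j :: int where "s = - t + 2 * of_int j * pi / of_int (l - m)"
proof -
  have n: "l - m > 0" and lm: "l \<noteq> m"
    using assms(2) by simp_all
  have cop: "coprime m (l - m)"
    using assms(1) by (rule coprime_diff_right_int)
  have n': "real_of_int (l - m) > 0"
    using n by linarith
  have "cos (of_int (l - m) * s) = cos (of_int (l - m) * t)"
    using arg_cong[OF eq, of "\<lambda>z. (norm z)\<^sup>2"] assms(3,4) by (simp add: norm_two_freq)
  then obtain j :: int where
    "of_int (l - m) * s = of_int (l - m) * t + 2 * of_int j * pi \<or>
     of_int (l - m) * s = - (of_int (l - m) * t) + 2 * of_int j * pi"
    unfolding cos_eq Ints_def by blast
  then show thesis
  proof
    assume "of_int (l - m) * s = of_int (l - m) * t + 2 * of_int j * pi"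
    then have s: "s = t + 2 * of_int j * pi / of_int (l - m)"
      using n' by (simp add: field_simps)
    have "cis (2 * pi * of_int m * of_int j / of_int (l - m)) = 1"
      using eq nz unfolding s two_freq_shift[OF lm] by simp
    then obtain q where q: "j = (l - m) * q"
      using cis_rational_eq_1_iff[OF n cop] by blast
    then have "s = t + 2 * pi * of_int q"
      using n' unfolding s q by (simp add: mult_ac del: of_int_diff)
    then have "[t = s] (rmod (2 * pi))"
      unfolding rcong_altdef by (auto simp: mult_ac)
    with ncong show thesis by blast
  next
    assume "of_int (l - m) * s = - (of_int (l - m) * t) + 2 * of_int j * pi"
    then have "s = - t + 2 * of_int j * pi / of_int (l - m)"
      using n' by (simp add: field_simps)
    then show thesis by (rule that)
  qed
qed

text \<open>
  The hypothesis on \<open>w\<close> gives its direction: the argument of \<open>w\<close> is a multiple of \<open>pi / n\<close>.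
  Whether a further rotation by a multiple of \<open>2 * pi / n\<close> takes it to the real axis is then a
  question of divisibility.
\<close>

lemma rotated_real_iff:
  fixes m n j k :: int
  assumes "n > 0" and "coprime m n" and "w \<noteq> 0"
    and w: "w = cis (2 * pi * of_int m * of_int j / of_int n) * cnj w"
  shows "cis (2 * pi * of_int m * of_int k / of_int n) * w \<in> \<real> \<longleftrightarrow> n dvd 2 * k + j"
proof -
  let ?c = "\<lambda>i. cis (2 * pi * of_int m * of_int i / of_int n)"
  have "?c k * w \<in> \<real> \<longleftrightarrow> cnj (?c k * w) = ?c k * w"
    by (rule Reals_cnj_iff)
  also have "\<dots> \<longleftrightarrow> ?c (- k) * cnj w = ?c k * (?c j * cnj w)"
    by (subst w[symmetric]) (simp add: cis_cnj)
  also have "\<dots> \<longleftrightarrow> ?c (- k) = ?c k * ?c j"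
    using \<open>w \<noteq> 0\<close> by (simp flip: mult.assoc)
  also have "\<dots> \<longleftrightarrow> ?c k * ?c (- k) = ?c k * (?c k * ?c j)"
    by simp
  also have "?c k * ?c (- k) = 1"
    by (simp add: cis_mult)
  also have "?c k * (?c k * ?c j) = ?c (2 * k + j)"
    by (simp add: cis_mult flip: add_divide_distrib) (simp add: algebra_simps)
  also have "1 = ?c (2 * k + j) \<longleftrightarrow> ?c (2 * k + j) = 1"
    by (rule eq_commute)
  also have "\<dots> \<longleftrightarrow> n dvd 2 * k + j"
    by (rule cis_rational_eq_1_iff[OF assms(1,2)])
  finally show ?thesis .
qed

lemma ex1_residue_dvd_double_plus:
  fixes n j :: int
  assumes "n > 0" and "odd n"
  shows "\<exists>!k. 0 \<le> k \<and> k \<le> n - 1 \<and> n dvd 2 * k + j"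
proof (rule ex_ex1I)
  obtain h where h: "n = 2 * h + 1"
    using \<open>odd n\<close> by (rule oddE)
  \<comment> \<open>\<open>h\<close> is an inverse of \<open>- 2\<close> modulo \<open>n\<close>.\<close>
  define k where "k = (h * j) mod n"
  have "(2 * k + j) mod n = (2 * (h * j) + j) mod n"
    unfolding k_def by (metis mod_add_left_eq mod_mult_right_eq)
  moreover have "2 * (h * j) + j = n * j"
    using h by (simp add: algebra_simps)
  ultimately have "n dvd 2 * k + j"
    by (simp add: dvd_eq_mod_eq_0)
  then show "\<exists>k. 0 \<le> k \<and> k \<le> n - 1 \<and> n dvd 2 * k + j"
    using \<open>n > 0\<close> by (intro exI[of _ k]) (simp add: k_def)
next
  fix k k'
  assume k: "0 \<le> k \<and> k \<le> n - 1 \<and> n dvd 2 * k + j"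
    and k': "0 \<le> k' \<and> k' \<le> n - 1 \<and> n dvd 2 * k' + j"
  have "n dvd 2 * (k - k')"
    using dvd_diff[of n "2 * k + j" "2 * k' + j"] k k' by (simp add: algebra_simps)
  then have "n dvd k - k'"
    using \<open>odd n\<close> coprime_dvd_mult_right_iff[of n 2 "k - k'"] coprime_right_2_iff_odd by blast
  then have "k mod n = k' mod n"
    by (simp only: mod_eq_dvd_iff)
  then show "k = k'"
    using k k' by simp
qed

theorem corollary5p8:
  fixes m l :: int and c1 c2 t0 s0 :: real and f :: "real \<Rightarrow> complex" and w0 :: complex
  assumes "coprime m l" and "l > m"
    and "c1 \<noteq> 0" and "c2 \<noteq> 0"
    and "\<And>t. f t = of_real c1 * exp (\<i> * of_real t * of_int m)
                  + of_real c2 * exp (\<i> * of_real t * of_int l)"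
    and "\<not> [t0 = s0] (rmod (2 * pi))"
    and "self_intersection_point f t0 s0 w0" and "w0 \<noteq> 0"
    and "odd (l - m)"
  shows "\<exists>!w. w \<in> module_class f m l t0 \<and> w \<in> \<real>"
proof -
  let ?c = "\<lambda>i. cis (2 * pi * of_int m * of_int i / of_int (l - m))"
  have n: "l - m > 0" and lm: "l \<noteq> m"
    using assms(2) by simp_all
  have cop: "coprime m (l - m)"
    using assms(1) by (rule coprime_diff_right_int)
  have f: "f = two_freq m l c1 c2"
    by (rule ext) (simp add: assms(5) two_freq_def cis_conv_exp mult_ac)
  have w_t: "w0 = two_freq m l c1 c2 t0" and w_s: "w0 = two_freq m l c1 c2 s0"
    using assms(7) unfolding self_intersection_point_def f by blast+
  have "two_freq m l c1 c2 t0 = two_freq m l c1 c2 s0" and "two_freq m l c1 c2 t0 \<noteq> 0"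
    using w_t w_s assms(8) by metis+
  from double_point_parameters[OF assms(1-4) this assms(6)]
  obtain j :: int where j: "s0 = - t0 + 2 * of_int j * pi / of_int (l - m)" .
  have w: "w0 = ?c j * cnj w0"
    using w_s unfolding j two_freq_shift[OF lm] two_freq_minus w_t[symmetric] .
  note real_iff = rotated_real_iff[OF n cop \<open>w0 \<noteq> 0\<close> w]
  have members: "module_class f m l t0 = {?c k * w0 | k. 0 \<le> k \<and> k \<le> l - m - 1}"
    unfolding module_class_def f two_freq_shift[OF lm] w_t[symmetric] ..
  show ?thesis
    unfolding members using ex1_residue_dvd_double_plus[OF n assms(9), of j] real_iff by blast
qed

end
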